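(* If $n\in\mathbb{N}$ and $p\in(1,2)$, then the open unit ball $B_{\ell_p^n}=\{z\in\mathbb{C}^n:\sum_{j=1}^n|z_j|^p<1\}$ of the complex Banach space $\ell_p^n$ is $1$-uniformly pseudoconvex.
   Context: $bU$ denotes the boundary of $U$. A $C^\ell$ defining function of $bU$ is a real-valued $r\in C^\ell(V)$ on a neighborhood $V$ of $bU$ such that $U\cap V=\{z\in V:r(z)<0\}$ and $Dr(w)\ne0$ for all $w\in bU$. For $V$ open in a complex Banach space $X$, an upper semicontinuous $g:V\to[-\infty,\infty)$ is uniformly plurisubharmonic on average if there exist a constant $L>0$ and a lower semicontinuous $\delta:V\to(0,\infty)$ such that for all $a\in V$ and $b\in X$ with $\|b\|<\delta(a)$ (where $\delta(a)$ is small enough that the closed disk $a+\overline{\mathbb{D}}b$ lies in $V$), $$L\|b\|^2+g(a)\le\frac1{2\pi}\int_0^{2\pi}g(a+e^{i\theta}b)\,d\theta.$$ For $\ell\ge1$, a bounded open domain $U$ in a Banach space $X$ is $\ell$-uniformly pseudoconvex if it admits a $C^\ell$ defining function of $bU$ (on some neighborhood $V$ of $bU$) which is uniformly plurisubharmonic on average on its domain $V$. *)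

theory Defs
  imports "HOL-Analysis.Analysis"
begin

text \<open>
  The exponent of \<open>\<ell>\<^sub>p\<^sup>n\<close> is a real parameter, so its norm cannot be the type class norm of a
  type.  Complex Banach spaces are therefore given by an explicit scalar multiplication and an
  explicit norm on a type, and all metric and differential notions below refer to that norm.
\<close>

locale complex_banach = vector_space scale
  for scale :: "complex \<Rightarrow> 'a::ab_group_add \<Rightarrow> 'a" +
  fixes N :: "'a \<Rightarrow> real"
  assumes N_eq_0_iff: "N x = 0 \<longleftrightarrow> x = 0"
    and N_triangle: "N (x + y) \<le> N x + N y"
    and N_scale: "N (scale c x) = cmod c * N x"
    and N_complete: "Metric_space.mcomplete UNIV (\<lambda>x y. N (x - y))"
begin

lemma N_minus_commute: "N (x - y) = N (y - x)"
  using N_scale[of "-1" "x - y"] by simp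

lemma N_nonneg: "0 \<le> N x"
  using N_triangle[of x "- x"] N_minus_commute[of 0 x] N_eq_0_iff[of 0] by simp

sublocale metric: Metric_space UNIV "\<lambda>x y. N (x - y)"
proof
  show "0 \<le> N (x - y)" for x y
    by (rule N_nonneg)
  show "N (x - y) = N (y - x)" for x y
    by (rule N_minus_commute)
  show "N (x - y) = 0 \<longleftrightarrow> x = y" for x y
    by (simp add: N_eq_0_iff)
  show "N (x - z) \<le> N (x - y) + N (y - z)" for x y z
    using N_triangle[of "x - y" "y - z"] by simp
qed

text \<open>
  Bounded real \<open>k\<close>-linear forms, represented as functions of argument lists of length \<open>k\<close>;
  values on lists of other lengths are irrelevant.
\<close>

definition bounded_multilinear :: "nat \<Rightarrow> ('a list \<Rightarrow> real) \<Rightarrow> bool" where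
  "bounded_multilinear k T \<longleftrightarrow>
     (\<forall>us vs. Suc (length us + length vs) = k \<longrightarrow>
        (\<forall>x y. T (us @ (x + y) # vs) = T (us @ x # vs) + T (us @ y # vs)) \<and>
        (\<forall>t x. T (us @ scale (of_real t) x # vs) = t * T (us @ x # vs))) \<and>
     (\<exists>C. \<forall>vs. length vs = k \<longrightarrow> \<bar>T vs\<bar> \<le> C * prod_list (map N vs))"

text \<open>
  \<open>D k x\<close> is the \<open>k\<close>-th real Frechet derivative of \<open>r\<close> at \<open>x\<close>, viewed as a \<open>k\<close>-linear form.
  The inequalities, being uniform in \<open>vs\<close>, express that \<open>x \<mapsto> D k x\<close> is Frechet differentiable
  with derivative \<open>D (Suc k)\<close> for \<open>k < l\<close>, and continuous for \<open>k = l\<close>, with respect to the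
  operator norm on \<open>k\<close>-linear forms.
\<close>

definition frechet_derivatives ::
  "nat \<Rightarrow> 'a set \<Rightarrow> ('a \<Rightarrow> real) \<Rightarrow> (nat \<Rightarrow> 'a \<Rightarrow> 'a list \<Rightarrow> real) \<Rightarrow> bool" where
  "frechet_derivatives l V r D \<longleftrightarrow>
     (\<forall>x\<in>V. D 0 x [] = r x) \<and>
     (\<forall>k\<le>l. \<forall>x\<in>V. bounded_multilinear k (D k x)) \<and>
     (\<forall>k<l. \<forall>x\<in>V. \<forall>e>0. \<exists>d>0. \<forall>h. N h < d \<longrightarrow> x + h \<in> V \<longrightarrow>
        (\<forall>vs. length vs = k \<longrightarrow>
          \<bar>D k (x + h) vs - D k x vs - D (Suc k) x (h # vs)\<bar>
            \<le> e * N h * prod_list (map N vs))) \<and>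
     (\<forall>x\<in>V. \<forall>e>0. \<exists>d>0. \<forall>y\<in>V. N (y - x) < d \<longrightarrow>
        (\<forall>vs. length vs = l \<longrightarrow> \<bar>D l y vs - D l x vs\<bar> \<le> e * prod_list (map N vs)))"

definition C_defining_function :: "nat \<Rightarrow> 'a set \<Rightarrow> 'a set \<Rightarrow> ('a \<Rightarrow> real) \<Rightarrow> bool" where
  "C_defining_function l U V r \<longleftrightarrow>
     openin metric.mtopology V \<and> metric.mtopology frontier_of U \<subseteq> V \<and>
     U \<inter> V = {z \<in> V. r z < 0} \<and>
     (\<exists>D. frechet_derivatives l V r D \<and>
       (\<forall>w \<in> metric.mtopology frontier_of U. \<exists>v. D 1 w [v] \<noteq> 0))"

text \<open>
  The library has no integral for \<open>ereal\<close>-valued functions; the mean is taken as the integral of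
  the positive part minus that of the negative part (\<open>e2ennreal\<close> sends negative values to 0).
  For \<open>g\<close> upper semicontinuous with values below \<open>\<infinity>\<close> the first one is finite.
\<close>

definition circle_mean :: "('a \<Rightarrow> ereal) \<Rightarrow> 'a \<Rightarrow> 'a \<Rightarrow> ereal" where
  "circle_mean g a b = ereal (1 / (2 * pi)) *
     (enn2ereal (\<integral>\<^sup>+\<theta>\<in>{0..2*pi}. e2ennreal (g (a + scale (cis \<theta>) b)) \<partial>lborel) -
      enn2ereal (\<integral>\<^sup>+\<theta>\<in>{0..2*pi}. e2ennreal (- g (a + scale (cis \<theta>) b)) \<partial>lborel))"

definition uniformly_psh_on_average :: "'a set \<Rightarrow> ('a \<Rightarrow> ereal) \<Rightarrow> bool" where
  "uniformly_psh_on_average V g \<longleftrightarrow>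
     openin metric.mtopology V \<and>
     (\<forall>z\<in>V. g z < \<infinity>) \<and> (\<forall>c. openin metric.mtopology {z \<in> V. g z < c}) \<and>
     (\<exists>(L::real) (\<delta> :: 'a \<Rightarrow> real).
        0 < L \<and>
        (\<forall>z\<in>V. 0 < \<delta> z) \<and> (\<forall>c. openin metric.mtopology {z \<in> V. c < \<delta> z}) \<and>
        (\<forall>a\<in>V. \<forall>b. N b < \<delta> a \<longrightarrow>
           (\<forall>\<zeta>. cmod \<zeta> \<le> 1 \<longrightarrow> a + scale \<zeta> b \<in> V) \<and>
           ereal (L * (N b)\<^sup>2) + g a \<le> circle_mean g a b))"

definition uniformly_pseudoconvex :: "nat \<Rightarrow> 'a set \<Rightarrow> bool" where
  "uniformly_pseudoconvex l U \<longleftrightarrow>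
     1 \<le> l \<and>
     openin metric.mtopology U \<and> U \<noteq> {} \<and> connectedin metric.mtopology U \<and> metric.mbounded U \<and>
     (\<exists>V r. C_defining_function l U V r \<and> uniformly_psh_on_average V (\<lambda>z. ereal (r z)))"

lemma circle_mean_ereal:
  assumes "continuous_on {0..2*pi} (\<lambda>\<theta>. r (a + scale (cis \<theta>) b))"
  shows "circle_mean (\<lambda>z. ereal (r z)) a b =
    ereal (1 / (2 * pi) * integral {0..2*pi} (\<lambda>\<theta>. r (a + scale (cis \<theta>) b)))"
proof -
  define f where "f \<theta> = r (a + scale (cis \<theta>) b)" for \<theta>
  define h where "h \<theta> = indicator {0..2*pi} \<theta> * f \<theta>" for \<theta>
  have cf: "continuous_on {0..2*pi} f"
    using assms by (simp add: f_def)
  have si: "set_integrable lborel {0..2*pi} f"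
    by (rule borel_integrable_atLeastAtMost'[OF cf])
  then have ih: "integrable lborel h"
    by (simp add: set_integrable_def h_def[abs_def])
  have eq: "integral {0..2*pi} f = integral\<^sup>L lborel h"
    using set_borel_integral_eq_integral(2)[OF si]
    by (simp add: set_lebesgue_integral_def h_def[abs_def] f_def[abs_def])
  have pos: "(\<integral>\<^sup>+\<theta>\<in>{0..2*pi}. e2ennreal (ereal (f \<theta>)) \<partial>lborel) = (\<integral>\<^sup>+\<theta>. ennreal (h \<theta>) \<partial>lborel)"
    by (intro nn_integral_cong) (auto simp: h_def indicator_def)
  have neg: "(\<integral>\<^sup>+\<theta>\<in>{0..2*pi}. e2ennreal (- ereal (f \<theta>)) \<partial>lborel) = (\<integral>\<^sup>+\<theta>. ennreal (- h \<theta>) \<partial>lborel)"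
    by (intro nn_integral_cong) (auto simp: h_def indicator_def)
  obtain P where P: "0 \<le> P" "(\<integral>\<^sup>+\<theta>. ennreal (h \<theta>) \<partial>lborel) = ennreal P"
    using real_integrable_def[of lborel h] ih
    by (metis ennreal_cases infinity_ennreal_def)
  obtain Q where Q: "0 \<le> Q" "(\<integral>\<^sup>+\<theta>. ennreal (- h \<theta>) \<partial>lborel) = ennreal Q"
    using real_integrable_def[of lborel h] ih
    by (metis ennreal_cases infinity_ennreal_def)
  have "integral\<^sup>L lborel h = P - Q"
    using real_lebesgue_integral_def[OF ih] P Q by simp
  then show ?thesis
    unfolding circle_mean_def f_def[symmetric] pos neg P(2) Q(2) eq
    using P(1) Q(1) by (simp add: enn2ereal_ennreal)
qed

end

definition lp_norm :: "real \<Rightarrow> complex^'n \<Rightarrow> real" where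
  "lp_norm p z = (\<Sum>j\<in>UNIV. cmod (z $ j) powr p) powr (1 / p)"

lemma lp_norm_nonneg: "0 \<le> lp_norm p z"
  by (simp add: lp_norm_def)

lemma lp_norm_powr:
  assumes "0 < p"
  shows "lp_norm p z powr p = (\<Sum>j\<in>UNIV. cmod (z $ j) powr p)"
  using assms by (simp add: lp_norm_def powr_powr sum_nonneg)

lemma lp_norm_eq_0_iff:
  assumes "0 < p"
  shows "lp_norm p z = 0 \<longleftrightarrow> z = 0"
  by (simp add: lp_norm_def sum_nonneg_eq_0_iff vec_eq_iff)

lemma lp_norm_scale:
  assumes "0 < p"
  shows "lp_norm p (c *s z) = cmod c * lp_norm p z"
proof -
  have "(\<Sum>j\<in>UNIV. cmod ((c *s z) $ j) powr p)
      = cmod c powr p * (\<Sum>j\<in>UNIV. cmod (z $ j) powr p)"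
    by (simp add: norm_mult powr_mult sum_distrib_left)
  then show ?thesis
    using assms by (simp add: lp_norm_def powr_mult sum_nonneg powr_powr)
qed

lemma powr_convex_combination:
  fixes p t u v :: real
  assumes p: "1 \<le> p" and t: "0 \<le> t" "t \<le> 1" and uv: "0 \<le> u" "0 \<le> v"
  shows "((1 - t) * u + t * v) powr p \<le> (1 - t) * u powr p + t * v powr p"
proof -
  have le: "s powr p \<le> s" if "0 \<le> s" "s \<le> 1" for s :: real
    using that p powr_mono'[of 1 p s] by (cases "s = 0") auto
  show ?thesis
  proof (cases "0 < u \<and> 0 < v")
    case True
    then show ?thesis
      using convex_onD[OF powr_convex[OF p] t, of u v] by simp
  next
    case False
    then consider "u = 0" | "v = 0"
      using uv by linarith
    then show ?thesis
    proof cases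
      case 1
      then show ?thesis
        using p mult_right_mono[OF le[OF t], of "v powr p"] t uv by (simp add: powr_mult)
    next
      case 2
      then show ?thesis
        using p mult_right_mono[OF le[of "1 - t"], of "u powr p"] t uv by (simp add: powr_mult)
    qed
  qed
qed

lemma lp_norm_triangle:
  assumes p: "1 \<le> p"
  shows "lp_norm p (x + y) \<le> lp_norm p x + lp_norm p y"
proof (cases "x = 0 \<or> y = 0")
  case True
  then show ?thesis
    using lp_norm_nonneg[of p] by auto
next
  case False
  define A B where "A = lp_norm p x" and "B = lp_norm p y"
  have p0: "0 < p"
    using p by simp
  have pos: "0 < A" "0 < B"
    using False lp_norm_eq_0_iff[OF p0] lp_norm_nonneg
    unfolding A_def B_def by (metis less_eq_real_def)+
  define t where "t = B / (A + B)"
  have t: "0 \<le> t" "t \<le> 1" "1 - t = A / (A + B)"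
    using pos by (auto simp: t_def field_simps)
  have comp: "cmod ((x + y) $ j) powr p \<le> (A + B) powr p *
      ((1 - t) * (cmod (x $ j) powr p / A powr p) + t * (cmod (y $ j) powr p / B powr p))" for j
  proof -
    have "cmod ((x + y) $ j) \<le> cmod (x $ j) + cmod (y $ j)"
      by (simp add: norm_triangle_ineq)
    also have "\<dots> = (A + B) * ((1 - t) * (cmod (x $ j) / A) + t * (cmod (y $ j) / B))"
      unfolding t(3) using pos by (simp add: t_def distrib_left)
    finally have "cmod ((x + y) $ j) powr p
        \<le> ((A + B) * ((1 - t) * (cmod (x $ j) / A) + t * (cmod (y $ j) / B))) powr p"
      using p by (intro powr_mono2) auto
    also have "\<dots> = (A + B) powr p * ((1 - t) * (cmod (x $ j) / A) + t * (cmod (y $ j) / B)) powr p"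
      by (rule powr_mult)
    also have "\<dots> \<le> (A + B) powr p *
        ((1 - t) * (cmod (x $ j) / A) powr p + t * (cmod (y $ j) / B) powr p)"
      using pos t by (intro mult_left_mono powr_convex_combination p) auto
    finally show ?thesis
      using pos by (simp add: powr_divide)
  qed
  have "(\<Sum>j\<in>UNIV. cmod ((x + y) $ j) powr p) \<le> (\<Sum>j\<in>UNIV. (A + B) powr p *
      ((1 - t) * (cmod (x $ j) powr p / A powr p) + t * (cmod (y $ j) powr p / B powr p)))"
    by (intro sum_mono comp)
  also have "\<dots> = (A + B) powr p *
      ((1 - t) * ((\<Sum>j\<in>UNIV. cmod (x $ j) powr p) / A powr p)
        + t * ((\<Sum>j\<in>UNIV. cmod (y $ j) powr p) / B powr p))"
    by (simp only: sum_distrib_left sum.distrib sum_divide_distrib distrib_left)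
  also have "\<dots> = (A + B) powr p"
    using pos p0 by (simp add: lp_norm_powr[symmetric] A_def[symmetric] B_def[symmetric])
  finally have "lp_norm p (x + y) \<le> ((A + B) powr p) powr (1 / p)"
    unfolding lp_norm_def using p by (intro powr_mono2) (auto intro: sum_nonneg)
  also have "\<dots> = A + B"
    using pos p0 by (simp add: powr_powr)
  finally show ?thesis
    by (simp add: A_def B_def)
qed

lemma cmod_component_le_lp_norm:
  assumes "0 < p"
  shows "cmod (z $ j) \<le> lp_norm p z"
proof -
  have "(cmod (z $ j) powr p) powr (1 / p) \<le> lp_norm p z"
    unfolding lp_norm_def using assms by (intro powr_mono2 member_le_sum) auto
  then show ?thesis
    using assms by (simp add: powr_powr)
qed

proposition complex_banach_lp_norm:
  assumes p: "1 \<le> p"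
  shows "complex_banach (*s) (lp_norm p :: complex^'n \<Rightarrow> real)"
proof -
  have p0: "0 < p"
    using p by simp
  let ?d = "\<lambda>x y :: complex^'n. lp_norm p (x - y)"
  interpret M: Metric_space UNIV ?d
  proof
    show "0 \<le> ?d x y" for x y
      by (rule lp_norm_nonneg)
    show "?d x y = ?d y x" for x y
      by (simp add: lp_norm_def norm_minus_commute)
    show "?d x y = 0 \<longleftrightarrow> x = y" for x y
      by (simp add: lp_norm_eq_0_iff[OF p0])
    show "?d x z \<le> ?d x y + ?d y z" for x y z
      using lp_norm_triangle[OF p, of "x - y" "y - z"] by simp
  qed
  have "M.mcomplete"
    unfolding M.mcomplete_def
  proof (intro allI impI)
    fix s assume s: "M.MCauchy s"
    have "Cauchy (\<lambda>n. s n $ j)" for j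
    proof (rule metric_CauchyI)
      fix e :: real assume "0 < e"
      then obtain K where K: "\<And>m n. K \<le> m \<Longrightarrow> K \<le> n \<Longrightarrow> ?d (s m) (s n) < e"
        using s unfolding M.MCauchy_def by blast
      have "dist (s m $ j) (s n $ j) < e" if "K \<le> m" "K \<le> n" for m n
        using K[OF that] cmod_component_le_lp_norm[OF p0, of "s m - s n" j]
        by (simp add: dist_norm)
      then show "\<exists>M. \<forall>m\<ge>M. \<forall>n\<ge>M. dist (s m $ j) (s n $ j) < e"
        by blast
    qed
    then have "\<forall>j. \<exists>l. (\<lambda>n. s n $ j) \<longlonglongrightarrow> l"
      using Cauchy_convergent convergent_def by blast
    then obtain l where l: "\<And>j. (\<lambda>n. s n $ j) \<longlonglongrightarrow> l j"
      by metis
    define x :: "complex^'n" where "x = (\<chi> j. l j)"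
    have "(\<lambda>n. cmod (s n $ j - x $ j)) \<longlonglongrightarrow> 0" for j
      using l[of j] tendsto_norm[OF tendsto_diff[OF l[of j] tendsto_const[of "l j"]]]
      by (simp add: x_def)
    then have "(\<lambda>n. cmod (s n $ j - x $ j) powr p) \<longlonglongrightarrow> 0" for j
      using p0 by (auto intro!: tendsto_zero_powrI)
    then have "(\<lambda>n. \<Sum>j\<in>UNIV. cmod (s n $ j - x $ j) powr p) \<longlonglongrightarrow> 0"
      by (intro tendsto_null_sum) auto
    then have "(\<lambda>n. (\<Sum>j\<in>UNIV. cmod (s n $ j - x $ j) powr p) powr (1 / p)) \<longlonglongrightarrow> 0"
      using p0 by (intro tendsto_zero_powrI[where b = "1 / p"]) (auto intro!: always_eventually sum_nonneg)
    then have lim: "(\<lambda>n. ?d (s n) x) \<longlonglongrightarrow> 0"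
      by (simp add: lp_norm_def)
    have "limitin M.mtopology s x sequentially"
      unfolding M.limitin_metric
    proof (intro conjI allI impI)
      fix e :: real assume "0 < e"
      then show "\<forall>\<^sub>F n in sequentially. s n \<in> UNIV \<and> ?d (s n) x < e"
        using order_tendstoD(2)[OF lim] by simp
    qed simp
    then show "\<exists>x. limitin M.mtopology s x sequentially"
      by blast
  qed
  then show ?thesis
    by unfold_locales
      (auto simp: lp_norm_eq_0_iff[OF p0] lp_norm_triangle[OF p] lp_norm_scale[OF p0])
qed

lemma lp_norm_unit_ball:
  assumes "0 < p"
  shows "lp_norm p z < 1 \<longleftrightarrow> (\<Sum>j\<in>UNIV. cmod (z $ j) powr p) < 1"
proof -
  let ?S = "\<Sum>j\<in>UNIV. cmod (z $ j) powr p"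
  have S: "0 \<le> ?S"
    by (simp add: sum_nonneg)
  show ?thesis
    using powr_less_mono2[of "1 / p" ?S 1] powr_mono2[of "1 / p" 1 ?S] assms S
    by (auto simp: lp_norm_def simp flip: not_less)
qed

end

theory Submission
  imports Defs
begin

text \<open>
  The natural defining function \<open>r z = (\<Sum>j. cmod (z $ j) powr p) - 1\<close> works, on the ball
  \<open>V\<close> of radius 2.  It is \<open>C\<^sup>1\<close> because \<open>p > 1\<close>: its gradient has the
  components \<open>p * cmod (z $ j) powr (p - 2) *\<^sub>R z $ j\<close>, and each of these tends to \<open>0\<close>
  where its coordinate vanishes.  On the unit sphere \<open>r\<close> has derivative \<open>p\<close> in the
  radial direction, by homogeneity.

  Uniform plurisubharmonicity comes from a stronger, purely real property, uniform convexity on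
  bounded sets.  For \<open>1 < p < 2\<close> the second derivative \<open>p * (p - 1) * x powr (p - 2)\<close> of
  \<open>x powr p\<close> decreases, hence it is at least its value at \<open>R\<close> on \<open>{0<..R}\<close>.  So, with
  \<open>c = p * (p - 1) / 2 * R powr (p - 2)\<close>, the function \<open>\<phi> x = x powr p - c * x\<^sup>2\<close> is
  convex and increasing on \<open>{0..R}\<close>, and \<open>\<phi>\<close> of the norm is midpoint convex on
  the ball of radius \<open>R\<close> of any inner product space.  The parallelogram law moves the quadratic
  term to the other side (\<open>norm_powr_midpoint\<close>):
  \<open>norm z powr p + c * (norm w)\<^sup>2 \<le> (norm (z + w) powr p + norm (z - w) powr p) / 2\<close>.
  Applied in each coordinate to \<open>a\<close> and \<open>cis \<theta> *s b\<close> and averaged over \<open>\<theta>\<close>, where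
  \<open>- cis \<theta> = cis (pi + \<theta>)\<close>, this bounds the circle mean of \<open>r\<close> from below by
  \<open>r a + c * (norm b)\<^sup>2\<close> with the Euclidean norm; in finite dimension the latter dominates a
  multiple of the \<open>\<ell>\<^sub>p\<close> norm.
\<close>

section \<open>Powers of a Hilbert space norm\<close>

text \<open>
  The formula includes the origin, where \<open>0 powr (p - 2) = 0\<close> makes it the zero map; there it
  holds because \<open>norm h powr p / norm h = norm h powr (p - 1)\<close> tends to \<open>0\<close>.
\<close>

lemma has_derivative_norm_powr:
  fixes x :: "'a::real_inner"
  assumes p: "1 < p"
  shows "((\<lambda>z. norm z powr p) has_derivative (\<lambda>h. ((p * norm x powr (p - 2)) *\<^sub>R x) \<bullet> h)) (at x)"
proof (cases "x = 0")
  case True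
  have "((\<lambda>h::'a. norm h powr (p - 1)) \<longlongrightarrow> 0) (at 0)"
    using p by (intro tendsto_zero_powrI tendsto_norm_zero tendsto_ident_at) auto
  moreover have "norm h powr (p - 1) = norm h powr p / norm h" for h :: 'a
    by (cases "h = 0") (simp_all add: powr_diff)
  ultimately show ?thesis
    using True p by (simp add: has_derivative_at)
next
  case False
  have "((\<lambda>z. norm z powr p) has_derivative
      (\<lambda>h. norm x powr p * (0 * ln (norm x) + (h \<bullet> sgn x) * p / norm x))) (at x)"
    using False by (intro has_derivative_powr has_derivative_norm has_derivative_const) auto
  moreover have "norm x powr p * (0 * ln (norm x) + (h \<bullet> sgn x) * p / norm x)
      = ((p * norm x powr (p - 2)) *\<^sub>R x) \<bullet> h" for h
    using False
    by (simp add: sgn_div_norm powr_diff power2_eq_square inner_commute[of h] field_simps)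
  ultimately show ?thesis
    by (simp only:)
qed

text \<open>
  In a Hilbert space this is the gradient of \<open>norm x powr p\<close> up to the factor \<open>p\<close>.
  Although \<open>norm x powr (p - 2)\<close> is
  unbounded near the origin for \<open>p < 2\<close>, the vector has norm \<open>norm x powr (p - 1)\<close>.
\<close>

lemma continuous_on_norm_powr_scaleR:
  fixes S :: "'a::real_normed_vector set"
  assumes p: "1 < p"
  shows "continuous_on S (\<lambda>x. norm x powr (p - 2) *\<^sub>R x)"
proof (rule continuous_at_imp_continuous_on, rule ballI)
  fix x :: 'a
  show "isCont (\<lambda>x. norm x powr (p - 2) *\<^sub>R x) x"
  proof (cases "x = 0")
    case True
    have lim: "((\<lambda>h::'a. norm h powr (p - 1)) \<longlongrightarrow> 0) (at 0)"
      using p by (intro tendsto_zero_powrI tendsto_norm_zero tendsto_ident_at) auto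
    have eq: "norm h powr (p - 1) = norm (norm h powr (p - 2) *\<^sub>R h)" for h :: 'a
      by (cases "h = 0") (simp_all add: powr_diff power2_eq_square)
    have "((\<lambda>h::'a. norm h powr (p - 2) *\<^sub>R h) \<longlongrightarrow> 0) (at 0)"
      using lim unfolding eq by (rule tendsto_norm_zero_cancel)
    then show ?thesis
      using True by (simp add: isCont_def)
  next
    case False
    then show ?thesis
      by (intro continuous_intros) auto
  qed
qed

section \<open>Uniform convexity of powers between one and two\<close>

text \<open>
  The second derivative \<open>p * (p - 1) * (x powr (p - 2) - R powr (p - 2))\<close> is nonnegative for
  \<open>0 < x \<le> R\<close>.  Since \<open>x powr p\<close> is not twice differentiable at \<open>0\<close>, the proof shows
  instead that the first derivative is monotone, comparing with its value \<open>0\<close> at the origin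
  separately.  The absolute value makes the function differentiable from both sides at \<open>0\<close>.
\<close>

lemma convex_on_powr_minus_square:
  assumes p: "1 < p" "p < 2"
  shows "convex_on {0..R} (\<lambda>x::real. \<bar>x\<bar> powr p - p * (p - 1) / 2 * R powr (p - 2) * x\<^sup>2)"
    (is "convex_on _ ?\<phi>")
proof (rule convex_on_realI)
  let ?d = "\<lambda>x::real. p * \<bar>x\<bar> powr (p - 2) * x - p * (p - 1) * R powr (p - 2) * x"
  show "connected {0..R}"
    by simp
  show "(?\<phi> has_real_derivative ?d x) (at x)" for x
  proof -
    have "((\<lambda>x. \<bar>x\<bar> powr p) has_real_derivative p * \<bar>x\<bar> powr (p - 2) * x) (at x)"
      using has_derivative_norm_powr[OF p(1), of x] by (simp add: has_field_derivative_def)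
    then show ?thesis
      by (rule DERIV_cong[OF DERIV_diff]) (auto intro!: derivative_eq_intros)
  qed
  show "?d x \<le> ?d y" if xy: "x \<in> {0..R}" "y \<in> {0..R}" "x \<le> y" for x y
  proof -
    have d: "?d t = p * t powr (p - 1) - p * (p - 1) * R powr (p - 2) * t" if "0 \<le> t" for t
      using that by (cases "t = 0") (simp_all add: powr_diff power2_eq_square)
    show ?thesis
    proof (cases "x = 0")
      case True
      have "(p - 1) * R powr (p - 2) \<le> 1 * y powr (p - 2)" if "0 < y"
        using p xy that by (intro mult_mono powr_mono2') auto
      then show ?thesis
        using True xy p
        by (cases "y = 0") (auto intro!: mult_right_mono simp: mult.assoc)
    next
      case False
      have "p * x powr (p - 1) - p * (p - 1) * R powr (p - 2) * x
          \<le> p * y powr (p - 1) - p * (p - 1) * R powr (p - 2) * y"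
      proof (rule DERIV_nonneg_imp_nondecreasing[OF xy(3)])
        fix t assume t: "x \<le> t" "t \<le> y"
        have "((\<lambda>t. p * t powr (p - 1) - p * (p - 1) * R powr (p - 2) * t) has_real_derivative
            p * (p - 1) * (t powr (p - 2) - R powr (p - 2))) (at t)"
          using t False xy
          by (auto intro!: derivative_eq_intros has_real_derivative_powr simp: algebra_simps)
        moreover have "R powr (p - 2) \<le> t powr (p - 2)"
          using p t False xy by (intro powr_mono2') auto
        ultimately show "\<exists>y. ((\<lambda>t. p * t powr (p - 1) - p * (p - 1) * R powr (p - 2) * t)
            has_real_derivative y) (at t) \<and> 0 \<le> y"
          using p by (intro exI conjI) auto
      qed
      then show ?thesis
        using d[of x] d[of y] xy by (simp only: atLeastAtMost_iff)
    qed
  qed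
qed

text \<open>
  A convex function that vanishes at \<open>0\<close> and is nonnegative is increasing; it is nonnegative
  here because the constant \<open>p * (p - 1) / 2\<close> is below \<open>1\<close>.
\<close>

lemma powr_minus_square_mono:
  assumes p: "1 < p" "p < 2" and xy: "0 \<le> x" "x \<le> y" "y \<le> R"
  shows "x powr p - p * (p - 1) / 2 * R powr (p - 2) * x\<^sup>2
    \<le> y powr p - p * (p - 1) / 2 * R powr (p - 2) * (y::real)\<^sup>2"
proof (cases "y = 0")
  case False
  define c where "c = p * (p - 1) / 2 * R powr (p - 2)"
  have y: "0 < y"
    using False xy by simp
  define t where "t = x / y"
  have t: "0 \<le> t" "t \<le> 1" "x = t * y"
    using xy y by (auto simp: t_def)
  have cv: "convex_on {0..R} (\<lambda>x::real. \<bar>x\<bar> powr p - c * x\<^sup>2)"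
    unfolding c_def by (rule convex_on_powr_minus_square[OF p])
  have "x powr p - c * x\<^sup>2 \<le> t * (y powr p - c * y\<^sup>2)"
    using convex_onD[OF cv t(1,2), of 0 y] t y xy by simp
  moreover have "0 \<le> y powr p - c * y\<^sup>2"
  proof -
    have "p * (p - 1) / 2 \<le> 2 * 1 / 2"
      using p by (intro divide_right_mono mult_mono) auto
    then have "c \<le> 1 * y powr (p - 2)"
      unfolding c_def using p xy y by (intro mult_mono powr_mono2') auto
    then have "c * y\<^sup>2 \<le> y powr (p - 2) * y\<^sup>2"
      by (intro mult_right_mono) auto
    also have "\<dots> = y powr p"
      using y by (simp add: powr_diff)
    finally show ?thesis
      by simp
  qed
  then have "t * (y powr p - c * y\<^sup>2) \<le> 1 * (y powr p - c * y\<^sup>2)"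
    using t by (intro mult_right_mono) auto
  ultimately show ?thesis
    by (simp add: c_def)
qed (use xy in simp)

text \<open>
  With \<open>\<phi> x = x powr p - c * x\<^sup>2\<close>, monotonicity and convexity of \<open>\<phi>\<close> give
  \<open>\<phi> (norm z) \<le> (\<phi> (norm (z + w)) + \<phi> (norm (z - w))) / 2\<close>; by the parallelogram law the
  squares on the right average to \<open>(norm z)\<^sup>2 + (norm w)\<^sup>2\<close>, and \<open>c * (norm z)\<^sup>2\<close> cancels.
\<close>

lemma norm_powr_midpoint:
  fixes z w :: "'a::real_inner"
  assumes p: "1 < p" "p < 2" and R: "norm (z + w) \<le> R" "norm (z - w) \<le> R"
  shows "norm z powr p + p * (p - 1) / 2 * R powr (p - 2) * (norm w)\<^sup>2
    \<le> (norm (z + w) powr p + norm (z - w) powr p) / 2"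
proof -
  define c where "c = p * (p - 1) / 2 * R powr (p - 2)"
  define \<phi> where "\<phi> x = \<bar>x\<bar> powr p - c * x\<^sup>2" for x :: real
  let ?u = "norm (z + w)" and ?v = "norm (z - w)"
  have cv: "convex_on {0..R} \<phi>"
    unfolding \<phi>_def c_def by (rule convex_on_powr_minus_square[OF p])
  have "2 * norm z = norm ((z + w) + (z - w))"
    by (simp flip: scaleR_2)
  then have m: "norm z \<le> (?u + ?v) / 2"
    using norm_triangle_ineq[of "z + w" "z - w"] by simp
  then have "\<phi> (norm z) \<le> \<phi> ((?u + ?v) / 2)"
    using powr_minus_square_mono[OF p norm_ge_zero m, of R] R by (simp add: \<phi>_def c_def)
  also have "\<dots> \<le> (\<phi> ?u + \<phi> ?v) / 2"
    using convex_onD[OF cv, of "1/2" ?u ?v] R by (simp add: field_simps)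
  finally have "norm z powr p - c * (norm z)\<^sup>2
      \<le> (?u powr p + ?v powr p) / 2 - c * ((?u\<^sup>2 + ?v\<^sup>2) / 2)"
    by (simp add: \<phi>_def field_simps)
  moreover have "(?u\<^sup>2 + ?v\<^sup>2) / 2 = (norm z)\<^sup>2 + (norm w)\<^sup>2"
    by (simp add: power2_norm_eq_inner inner_simps)
  ultimately show ?thesis
    by (simp only: c_def[symmetric] distrib_left)
qed

text \<open>
  Averaging over antipodal pairs first turns a midpoint estimate into an estimate of the mean.
\<close>

lemma circle_average_ge:
  fixes f :: "real \<Rightarrow> real"
  assumes f: "continuous_on {0..2*pi} f"
    and le: "\<And>\<theta>. 0 \<le> \<theta> \<Longrightarrow> \<theta> \<le> pi \<Longrightarrow> c \<le> (f \<theta> + f (pi + \<theta>)) / 2"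
  shows "c \<le> 1 / (2 * pi) * integral {0..2*pi} f"
proof -
  have i: "f integrable_on {0..pi}" "(f \<circ> (+) pi) integrable_on {0..pi}"
    by (auto intro!: integrable_continuous_real continuous_on_compose continuous_intros
        continuous_on_subset[OF f])
  have "integral {0..2*pi} f = integral {0..pi} f + integral {pi..2*pi} f"
    using integrable_continuous_real[OF f] by (intro Henstock_Kurzweil_Integration.integral_combine[symmetric]) auto
  also have "integral {pi..2*pi} f = integral {0..pi} (f \<circ> (+) pi)"
    using integral_shift_Icc_real[of 0 pi f pi] by simp
  also have "integral {0..pi} f + integral {0..pi} (f \<circ> (+) pi)
      = integral {0..pi} (\<lambda>\<theta>. f \<theta> + (f \<circ> (+) pi) \<theta>)"
    using i by (rule Henstock_Kurzweil_Integration.integral_add[symmetric])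
  also have "\<dots> \<ge> integral {0..pi} (\<lambda>\<theta>. 2 * c)"
    using i le by (intro integral_le Henstock_Kurzweil_Integration.integrable_add) force+
  finally show ?thesis
    by (simp add: field_simps)
qed

section \<open>Comparison with the Euclidean norm\<close>

lemma of_real_vector_mult:
  fixes x :: "complex^'n"
  shows "complex_of_real t *s x = t *\<^sub>R x"
  by (simp add: vec_eq_iff) (simp add: scaleR_conv_of_real)

lemma norm_le_lp_norm:
  fixes z :: "complex^'n"
  assumes "0 < p"
  shows "norm z \<le> CARD('n) * lp_norm p z"
proof -
  have "norm z \<le> (\<Sum>j\<in>UNIV. cmod (z $ j))"
    by (simp add: norm_vec_def L2_set_le_sum)
  also have "\<dots> \<le> (\<Sum>j\<in>(UNIV::'n set). lp_norm p z)"
    by (intro sum_mono cmod_component_le_lp_norm assms)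
  finally show ?thesis
    by simp
qed

lemma lp_norm_le_norm:
  fixes z :: "complex^'n"
  assumes "0 < p"
  shows "lp_norm p z \<le> CARD('n) powr (1 / p) * norm z"
proof -
  have "(\<Sum>j\<in>UNIV. cmod (z $ j) powr p) \<le> (\<Sum>j\<in>(UNIV::'n set). norm z powr p)"
    using assms by (intro sum_mono powr_mono2 Finite_Cartesian_Product.norm_nth_le) auto
  then have "lp_norm p z \<le> (CARD('n) * norm z powr p) powr (1 / p)"
    unfolding lp_norm_def using assms by (intro powr_mono2) (auto intro: sum_nonneg)
  then show ?thesis
    using assms by (simp add: powr_mult powr_powr)
qed

text \<open>
  Openness and frontiers in the \<open>\<ell>\<^sub>p\<close> metric are thereby the type class notions, so that the
  library's facts on continuous functions apply.
\<close>

lemma lp_mtopology: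
  assumes p: "1 \<le> p"
  shows "Metric_space.mtopology UNIV (\<lambda>x y :: complex^'n. lp_norm p (x - y)) = euclidean"
proof -
  interpret B: complex_banach "(*s)" "lp_norm p :: complex^'n \<Rightarrow> real"
    by (rule complex_banach_lp_norm[OF p])
  have p0: "0 < p"
    using p by simp
  define C where "C = real CARD('n)"
  define K where "K = C powr (1 / p)"
  have CK: "0 < C" "0 < K"
    by (auto simp: C_def K_def)
  have C: "norm z \<le> C * lp_norm p z" for z :: "complex^'n"
    unfolding C_def by (rule norm_le_lp_norm[OF p0])
  have K: "lp_norm p z \<le> K * norm z" for z :: "complex^'n"
    unfolding K_def C_def by (rule lp_norm_le_norm[OF p0])
  have 1: "B.metric.mball x (e / C) \<subseteq> ball x e" for x :: "complex^'n" and e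
  proof
    fix y assume "y \<in> B.metric.mball x (e / C)"
    then show "y \<in> ball x e"
      using C[of "x - y"] CK by (auto simp: dist_norm field_simps)
  qed
  have 2: "ball x (e / K) \<subseteq> B.metric.mball x e" for x :: "complex^'n" and e
  proof
    fix y assume "y \<in> ball x (e / K)"
    then show "y \<in> B.metric.mball x e"
      using K[of "x - y"] CK by (auto simp: dist_norm field_simps)
  qed
  have "openin B.metric.mtopology S \<longleftrightarrow> open S" for S
  proof
    assume S: "openin B.metric.mtopology S"
    show "open S"
      unfolding open_contains_ball
    proof
      fix x assume "x \<in> S"
      then obtain e where "0 < e" "B.metric.mball x e \<subseteq> S"
        using S unfolding B.metric.openin_mtopology by blast
      then have "0 < e / K" "ball x (e / K) \<subseteq> S"
        using CK 2[of x e] by auto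
      then show "\<exists>e>0. ball x e \<subseteq> S"
        by blast
    qed
  next
    assume S: "open S"
    show "openin B.metric.mtopology S"
      unfolding B.metric.openin_mtopology
    proof (intro conjI allI impI)
      fix x assume "x \<in> S"
      then obtain e where "0 < e" "ball x e \<subseteq> S"
        using S unfolding open_contains_ball by blast
      then have "0 < e / C" "B.metric.mball x (e / C) \<subseteq> S"
        using CK 1[of x e] by auto
      then show "\<exists>r>0. B.metric.mball x r \<subseteq> S"
        by blast
    qed simp
  qed
  then show ?thesis
    by (simp add: topology_eq)
qed

section \<open>The defining function\<close>

definition lp_sum :: "real \<Rightarrow> complex^'n \<Rightarrow> real" where
  "lp_sum p z = (\<Sum>j\<in>UNIV. cmod (z $ j) powr p)"

definition lp_sum_gradient :: "real \<Rightarrow> complex^'n \<Rightarrow> complex^'n" where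
  "lp_sum_gradient p z = (\<chi> j. (p * cmod (z $ j) powr (p - 2)) *\<^sub>R z $ j)"

lemma has_derivative_lp_sum:
  fixes z :: "complex^'n"
  assumes "1 < p"
  shows "(lp_sum p has_derivative (\<lambda>h. lp_sum_gradient p z \<bullet> h)) (at z)"
  unfolding lp_sum_def[abs_def] lp_sum_gradient_def inner_vec_def
proof (rule has_derivative_sum)
  fix j :: 'n
  have "((\<lambda>z. z $ j) has_derivative (\<lambda>h. h $ j)) (at z)"
    by (intro bounded_linear_imp_has_derivative bounded_linear_vec_nth)
  from has_derivative_compose[OF this has_derivative_norm_powr[OF assms]]
  show "((\<lambda>z. cmod (z $ j) powr p) has_derivative
      (\<lambda>h. (\<chi> j. (p * cmod (z $ j) powr (p - 2)) *\<^sub>R z $ j) $ j \<bullet> h $ j)) (at z)"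
    by simp
qed

lemma continuous_on_lp_sum:
  assumes "1 < p"
  shows "continuous_on S (lp_sum p)"
proof (rule continuous_at_imp_continuous_on, rule ballI)
  show "isCont (lp_sum p) x" for x
    by (rule has_derivative_continuous[OF has_derivative_lp_sum[OF assms]])
qed

lemma continuous_on_lp_norm:
  assumes "1 < p"
  shows "continuous_on S (lp_norm p)"
proof -
  have "continuous_on S (\<lambda>z. lp_sum p z powr (1 / p))"
    using assms by (intro continuous_on_powr' continuous_on_lp_sum continuous_on_const)
      (auto simp: lp_sum_def sum_nonneg)
  then show ?thesis
    by (simp add: lp_norm_def lp_sum_def)
qed

lemma continuous_on_lp_sum_gradient:
  fixes S :: "(complex^'n) set"
  assumes "1 < p"
  shows "continuous_on S (lp_sum_gradient p)"
proof -
  have "continuous_on S (\<lambda>z. p *\<^sub>R (cmod (z $ j) powr (p - 2) *\<^sub>R z $ j))" for j :: 'n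
    by (intro continuous_intros continuous_on_compose2[OF continuous_on_norm_powr_scaleR[OF assms, of UNIV]]) auto
  then show ?thesis
    unfolding lp_sum_gradient_def[abs_def] by (intro continuous_on_vec_lambda) simp
qed

lemma lp_sum_gradient_inner_self:
  "lp_sum_gradient p z \<bullet> z = p * lp_sum p z"
proof -
  have "cmod w powr (p - 2) * (w \<bullet> w) = cmod w powr p" for w
    unfolding dot_square_norm by (cases "w = 0") (simp_all add: powr_diff)
  then show ?thesis
    by (simp add: lp_sum_gradient_def lp_sum_def inner_vec_def mult.assoc flip: sum_distrib_left)
qed

text \<open>
  Passing from Euclidean to \<open>\<ell>\<^sub>p\<close> estimates costs only the factor \<open>C\<close> of
  \<open>norm_le_lp_norm\<close>, once in the radius \<open>d\<close> and once in the tolerance \<open>e\<close>.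
\<close>

lemma frechet_derivatives_lp_sum:
  fixes V :: "(complex^'n) set"
  assumes p: "1 < p"
  shows "complex_banach.frechet_derivatives (*s) (lp_norm p) 1 V (\<lambda>z. lp_sum p z - 1)
    (\<lambda>k x vs. if k = 0 then lp_sum p x - 1 else lp_sum_gradient p x \<bullet> hd vs)"
proof -
  interpret B: complex_banach "(*s)" "lp_norm p :: complex^'n \<Rightarrow> real"
    using p by (intro complex_banach_lp_norm) simp
  let ?D = "\<lambda>k x vs. if k = 0 then lp_sum p x - 1 else lp_sum_gradient p x \<bullet> hd vs"
  define C where "C = real CARD('n)"
  have C0: "0 < C"
    by (simp add: C_def)
  have C: "norm z \<le> C * lp_norm p z" for z :: "complex^'n"
    using p unfolding C_def by (intro norm_le_lp_norm) simp
  have multilinear: "B.bounded_multilinear k (?D k x)" if "k \<le> 1" for k and x :: "complex^'n"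
  proof (cases "k = 0")
    case True
    then show ?thesis
      by (auto simp: B.bounded_multilinear_def)
  next
    case False
    with that have k: "k = 1"
      by simp
    have "\<bar>lp_sum_gradient p x \<bullet> v\<bar> \<le> norm (lp_sum_gradient p x) * C * lp_norm p v" for v
      using Cauchy_Schwarz_ineq2[of "lp_sum_gradient p x" v]
        mult_left_mono[OF C[of v] norm_ge_zero[of "lp_sum_gradient p x"]] by (simp add: mult.assoc)
    then have "\<exists>K. \<forall>vs. length vs = 1 \<longrightarrow>
        \<bar>lp_sum_gradient p x \<bullet> hd vs\<bar> \<le> K * prod_list (map (lp_norm p) vs)"
      by (intro exI[of _ "norm (lp_sum_gradient p x) * C"]) (auto simp: length_Suc_conv)
    then show ?thesis
      by (auto simp: k B.bounded_multilinear_def of_real_vector_mult inner_add_right)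
  qed
  have derivative: "\<exists>d>0. \<forall>h. lp_norm p h < d \<longrightarrow>
      \<bar>lp_sum p (x + h) - lp_sum p x - lp_sum_gradient p x \<bullet> h\<bar> \<le> e * lp_norm p h"
    if e: "0 < e" for x :: "complex^'n" and e
  proof -
    obtain d where d: "d > 0" and *: "\<And>y. norm (y - x) < d \<Longrightarrow>
        \<bar>lp_sum p y - lp_sum p x - lp_sum_gradient p x \<bullet> (y - x)\<bar> \<le> e / C * norm (y - x)"
      using has_derivative_lp_sum[OF p, of x] e C0
      unfolding has_derivative_at_alt real_norm_def by (meson divide_pos_pos)
    show ?thesis
    proof (intro exI[of _ "d / C"] conjI allI impI)
      show "0 < d / C"
        using d C0 by simp
      fix h :: "complex^'n" assume "lp_norm p h < d / C"
      then have "norm h < d"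
        using C[of h] C0 by (simp add: field_simps)
      then have "\<bar>lp_sum p (x + h) - lp_sum p x - lp_sum_gradient p x \<bullet> h\<bar> \<le> e / C * norm h"
        using *[of "x + h"] by simp
      also have "\<dots> \<le> e / C * (C * lp_norm p h)"
        using C[of h] e C0 by (intro mult_left_mono) auto
      finally show "\<bar>lp_sum p (x + h) - lp_sum p x - lp_sum_gradient p x \<bullet> h\<bar> \<le> e * lp_norm p h"
        using C0 by simp
    qed
  qed
  have continuous: "\<exists>d>0. \<forall>y\<in>V. lp_norm p (y - x) < d \<longrightarrow> (\<forall>vs. length vs = Suc 0 \<longrightarrow>
      \<bar>lp_sum_gradient p y \<bullet> hd vs - lp_sum_gradient p x \<bullet> hd vs\<bar>
        \<le> e * prod_list (map (lp_norm p) vs))"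
    if e: "0 < e" for x :: "complex^'n" and e
  proof -
    have "isCont (lp_sum_gradient p) x"
      using continuous_on_lp_sum_gradient[OF p, of "UNIV :: (complex^'n) set"]
      by (simp add: continuous_on_eq_continuous_at)
    then obtain d where d: "d > 0" and *: "\<And>y. norm (y - x) < d \<Longrightarrow>
        norm (lp_sum_gradient p y - lp_sum_gradient p x) < e / C"
      using e C0 unfolding continuous_at_eps_delta dist_norm by (meson divide_pos_pos)
    show ?thesis
    proof (intro exI[of _ "d / C"] conjI ballI allI impI)
      show "0 < d / C"
        using d C0 by simp
      fix y and vs :: "(complex^'n) list"
      assume y: "lp_norm p (y - x) < d / C" and vs: "length vs = Suc 0"
      then obtain v where v: "vs = [v]"
        by (auto simp: length_Suc_conv)
      have "norm (y - x) < d"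
        using y C[of "y - x"] C0 by (simp add: field_simps)
      then have le: "norm (lp_sum_gradient p y - lp_sum_gradient p x) \<le> e / C"
        using * less_imp_le by blast
      have "\<bar>(lp_sum_gradient p y - lp_sum_gradient p x) \<bullet> v\<bar>
          \<le> norm (lp_sum_gradient p y - lp_sum_gradient p x) * norm v"
        by (rule Cauchy_Schwarz_ineq2)
      also have "\<dots> \<le> e / C * (C * lp_norm p v)"
        using e C0 C by (intro mult_mono le) auto
      finally show "\<bar>lp_sum_gradient p y \<bullet> hd vs - lp_sum_gradient p x \<bullet> hd vs\<bar>
          \<le> e * prod_list (map (lp_norm p) vs)"
        using C0 by (simp add: v inner_diff_left)
    qed
  qed
  show ?thesis
    unfolding B.frechet_derivatives_def
  proof (intro conjI allI ballI impI)
    fix k :: nat and x :: "complex^'n" and e :: real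
    assume "k < 1" "0 < e"
    then show "\<exists>d>0. \<forall>h. lp_norm p h < d \<longrightarrow> x + h \<in> V \<longrightarrow> (\<forall>vs. length vs = k \<longrightarrow>
        \<bar>?D k (x + h) vs - ?D k x vs - ?D (Suc k) x (h # vs)\<bar>
          \<le> e * lp_norm p h * prod_list (map (lp_norm p) vs))"
      using derivative[of e x] by simp blast
  qed (use multilinear continuous in simp_all)
qed

lemma lp_sum_midpoint:
  fixes a h :: "complex^'n"
  assumes p: "1 < p" "p < 2" and R: "lp_norm p (a + h) \<le> R" "lp_norm p (a - h) \<le> R"
  shows "lp_sum p a + p * (p - 1) / 2 * R powr (p - 2) * (norm h)\<^sup>2
    \<le> (lp_sum p (a + h) + lp_sum p (a - h)) / 2"
proof -
  have "cmod (a $ j) powr p + p * (p - 1) / 2 * R powr (p - 2) * (cmod (h $ j))\<^sup>2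
      \<le> (cmod ((a + h) $ j) powr p + cmod ((a - h) $ j) powr p) / 2" for j
    using p R cmod_component_le_lp_norm[of p "a + h" j] cmod_component_le_lp_norm[of p "a - h" j]
      norm_powr_midpoint[OF p, of "a $ j" "h $ j" R] by simp
  then have "(\<Sum>j\<in>UNIV. cmod (a $ j) powr p + p * (p - 1) / 2 * R powr (p - 2) * (cmod (h $ j))\<^sup>2)
      \<le> (\<Sum>j\<in>UNIV. (cmod ((a + h) $ j) powr p + cmod ((a - h) $ j) powr p) / 2)"
    by (rule sum_mono)
  then show ?thesis
    by (simp add: lp_sum_def norm_vec_def L2_set_def sum_nonneg sum.distrib
        flip: sum_distrib_left sum_divide_distrib)
qed

text \<open>
  The radius \<open>\<delta> a = R - lp_norm p a\<close> keeps the whole disk inside the ball, where the constant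
  of the midpoint inequality is valid.
\<close>

lemma uniformly_psh_lp_sum:
  assumes p: "1 < p" "p < 2" and R: "0 < R"
  shows "complex_banach.uniformly_psh_on_average (*s) (lp_norm p)
    {z :: complex^'n. lp_norm p z < R} (\<lambda>z. ereal (lp_sum p z - 1))"
proof -
  interpret B: complex_banach "(*s)" "lp_norm p :: complex^'n \<Rightarrow> real"
    using p by (intro complex_banach_lp_norm) simp
  have top: "B.metric.mtopology = euclidean"
    using p by (intro lp_mtopology) simp
  let ?V = "{z :: complex^'n. lp_norm p z < R}"
  have Vopen: "open ?V"
    by (intro open_Collect_less continuous_on_lp_norm p continuous_intros)
  define c where "c = p * (p - 1) / 2 * R powr (p - 2)"
  have c: "0 < c"
    using p R by (simp add: c_def)
  define K where "K = real CARD('n) powr (1 / p)"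
  have K0: "0 < K"
    by (simp add: K_def)
  have K: "lp_norm p z \<le> K * norm z" for z :: "complex^'n"
    using p unfolding K_def by (intro lp_norm_le_norm) simp
  have "open {z \<in> ?V. ereal (lp_sum p z - 1) < u}" for u
  proof -
    have "open {z :: complex^'n. ereal (lp_sum p z - 1) < u}"
      by (intro open_Collect_less continuous_on_ereal continuous_on_lp_sum continuous_intros p)
    then show ?thesis
      using Vopen by (simp add: Collect_conj_eq open_Int)
  qed
  moreover have "open {z \<in> ?V. u < R - lp_norm p z}" for u
  proof -
    have "open {z :: complex^'n. u < R - lp_norm p z}"
      by (intro open_Collect_less continuous_on_lp_norm continuous_intros p)
    then show ?thesis
      using Vopen by (simp add: Collect_conj_eq open_Int)
  qed
  moreover have disk: "lp_norm p (a + \<zeta> *s b) < R"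
    if "lp_norm p b < R - lp_norm p a" "cmod \<zeta> \<le> 1" for a b :: "complex^'n" and \<zeta>
  proof -
    have "lp_norm p (a + \<zeta> *s b) \<le> lp_norm p a + cmod \<zeta> * lp_norm p b"
      using B.N_triangle[of a "\<zeta> *s b"] by (simp add: B.N_scale)
    also have "cmod \<zeta> * lp_norm p b \<le> 1 * lp_norm p b"
      using that(2) lp_norm_nonneg by (intro mult_right_mono)
    finally show ?thesis
      using that(1) by simp
  qed
  moreover have "ereal (c / K\<^sup>2 * (lp_norm p b)\<^sup>2) + ereal (lp_sum p a - 1)
      \<le> B.circle_mean (\<lambda>z. ereal (lp_sum p z - 1)) a b"
    if b: "lp_norm p b < R - lp_norm p a" for a b :: "complex^'n"
  proof -
    let ?f = "\<lambda>\<theta>. lp_sum p (a + cis \<theta> *s b) - 1"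
    have cont: "continuous_on {0..2*pi} ?f"
    proof -
      have "continuous_on {0..2*pi} (\<lambda>\<theta>. a + cis \<theta> *s b)"
        unfolding vector_scalar_mult_def
        by (intro continuous_intros continuous_on_vec_lambda continuous_on_cis)
      from continuous_on_compose2[OF continuous_on_lp_sum[OF p(1), of UNIV] this]
      show ?thesis
        by (intro continuous_on_diff continuous_on_const) auto
    qed
    have "(lp_norm p b)\<^sup>2 \<le> (K * norm b)\<^sup>2"
      using K lp_norm_nonneg by (intro power_mono) auto
    then have "c / K\<^sup>2 * (lp_norm p b)\<^sup>2 \<le> c / K\<^sup>2 * (K\<^sup>2 * (norm b)\<^sup>2)"
      using c by (intro mult_left_mono) (auto simp: power_mult_distrib)
    also have "\<dots> = c * (norm b)\<^sup>2"
      using K0 by simp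
    finally have "c / K\<^sup>2 * (lp_norm p b)\<^sup>2 + (lp_sum p a - 1) \<le> lp_sum p a - 1 + c * (norm b)\<^sup>2"
      by simp
    also have "\<dots> \<le> 1 / (2 * pi) * integral {0..2*pi} ?f"
    proof (rule circle_average_ge[OF cont])
      fix \<theta>
      have nb: "norm (cis \<theta> *s b) = norm b"
        by (simp add: norm_vec_def norm_mult)
      have op: "cis (pi + \<theta>) *s b = - (cis \<theta> *s b)"
        by (simp add: vec_eq_iff flip: cis_mult)
      have "lp_norm p (a + cis \<theta> *s b) \<le> R" "lp_norm p (a - cis \<theta> *s b) \<le> R"
        using disk[OF b, of "cis \<theta>"] disk[OF b, of "cis (pi + \<theta>)"] op by auto
      from lp_sum_midpoint[OF p this]
      show "lp_sum p a - 1 + c * (norm b)\<^sup>2 \<le> (?f \<theta> + ?f (pi + \<theta>)) / 2"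
        unfolding op nb c_def by (simp add: field_simps)
    qed
    finally show ?thesis
      using B.circle_mean_ereal[of "\<lambda>z. lp_sum p z - 1" a b] cont by simp
  qed
  ultimately show ?thesis
    unfolding B.uniformly_psh_on_average_def top
    using Vopen c K0
    by (intro conjI exI[of _ "c / K\<^sup>2"] exI[of _ "\<lambda>z. R - lp_norm p z"]) auto
qed

text \<open>
  Any radius above \<open>1\<close> would do for the neighborhood \<open>V\<close> of the sphere; as \<open>V\<close> is then a
  ball that contains the domain, \<open>U \<inter> V\<close> is \<open>U\<close> itself.
\<close>

theorem proposition3p11:
  fixes p :: real
  assumes "1 < p" and "p < 2"
  shows "complex_banach.uniformly_pseudoconvex (*s) (lp_norm p) 1
           {z :: complex^'n. (\<Sum>j\<in>UNIV. cmod (z $ j) powr p) < 1}"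
proof -
  interpret B: complex_banach "(*s)" "lp_norm p :: complex^'n \<Rightarrow> real"
    using assms by (intro complex_banach_lp_norm) simp
  have top: "B.metric.mtopology = euclidean"
    using assms by (intro lp_mtopology) simp
  define U where "U = {z :: complex^'n. lp_sum p z < 1}"
  define V where "V = {z :: complex^'n. lp_norm p z < 2}"
  have ball: "lp_sum p z < 1 \<longleftrightarrow> lp_norm p z < 1" for z :: "complex^'n"
    using lp_norm_unit_ball[of p z] assms by (simp add: lp_sum_def)
  have U: "open U"
    unfolding U_def by (intro open_Collect_less continuous_on_lp_sum assms continuous_intros)
  have V: "open V"
    unfolding V_def by (intro open_Collect_less continuous_on_lp_norm assms continuous_intros)
  have "0 \<in> U"
    by (simp add: U_def lp_sum_def)
  have "convex U"
  proof (rule convexI)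
    fix x y :: "complex^'n" and u v :: real
    assume xy: "x \<in> U" "y \<in> U" and uv: "0 \<le> u" "0 \<le> v" "u + v = 1"
    have "lp_norm p (u *\<^sub>R x + v *\<^sub>R y) \<le> u * lp_norm p x + v * lp_norm p y"
      using B.N_triangle[of "u *\<^sub>R x" "v *\<^sub>R y"] uv
      by (simp add: B.N_scale flip: of_real_vector_mult)
    also have "\<dots> < 1"
      using convex_bound_lt[of "lp_norm p x" 1 "lp_norm p y" u v] xy uv by (simp add: U_def ball)
    finally show "u *\<^sub>R x + v *\<^sub>R y \<in> U"
      by (simp add: U_def ball)
  qed
  have frontier: "lp_sum p w = 1" if "w \<in> frontier U" for w
  proof -
    have "w \<notin> U"
      using that U by (simp add: frontier_def interior_open)
    moreover have "closed {z :: complex^'n. lp_sum p z \<le> 1}"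
      by (intro closed_Collect_le continuous_on_lp_sum assms continuous_intros)
    then have "closure U \<subseteq> {z. lp_sum p z \<le> 1}"
      by (intro closure_minimal) (auto simp: U_def)
    ultimately show ?thesis
      using that by (force simp: U_def frontier_def)
  qed
  have "B.C_defining_function 1 U V (\<lambda>z. lp_sum p z - 1)"
    unfolding B.C_defining_function_def top
  proof (intro conjI exI)
    show "openin euclidean V"
      using V by simp
    show "euclidean frontier_of U \<subseteq> V"
      using frontier assms by (auto simp: V_def lp_norm_def lp_sum_def)
    show "U \<inter> V = {z \<in> V. lp_sum p z - 1 < 0}"
      by (auto simp: U_def)
    show "B.frechet_derivatives 1 V (\<lambda>z. lp_sum p z - 1)
        (\<lambda>k x vs. if k = 0 then lp_sum p x - 1 else lp_sum_gradient p x \<bullet> hd vs)"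
      by (rule frechet_derivatives_lp_sum[OF assms(1)])
    show "\<forall>w\<in>euclidean frontier_of U. \<exists>v. (if (1::nat) = 0 then lp_sum p w - 1
        else lp_sum_gradient p w \<bullet> hd [v]) \<noteq> 0"
    proof
      fix w assume "w \<in> euclidean frontier_of U"
      then have "lp_sum_gradient p w \<bullet> w = p"
        using frontier by (simp add: lp_sum_gradient_inner_self)
      then show "\<exists>v. (if (1::nat) = 0 then lp_sum p w - 1 else lp_sum_gradient p w \<bullet> hd [v]) \<noteq> 0"
        using assms by (intro exI[of _ w]) simp
    qed
  qed
  moreover have "B.metric.mbounded U"
  proof -
    have "lp_norm p (- x) = lp_norm p x" for x :: "complex^'n"
      by (simp add: lp_norm_def)
    then have "U \<subseteq> B.metric.mcball 0 1"
      by (auto simp: U_def ball)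
    then show ?thesis
      by (auto simp: B.metric.mbounded_def)
  qed
  ultimately have "B.uniformly_pseudoconvex 1 U"
    unfolding B.uniformly_pseudoconvex_def top
    using U \<open>0 \<in> U\<close> \<open>convex U\<close> uniformly_psh_lp_sum[OF assms, of 2]
    by (auto simp: V_def convex_connected)
  then show ?thesis
    by (simp add: U_def lp_sum_def)
qed

end
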